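(* Consider the words $w$ and $w^{*}$ of length $n-1$, the associated snake graphs $G_w$ and $G_w^{*}=G_{w^*}$ with $n$ tiles, and the distributive lattices $D_w\cong\mathbb P_w\cong\mathbb L_{w^{*}}$ and $D_{w^{*}}\cong\mathbb L_w\cong\mathbb P_{w^{*}}$ of rank $n$. (a) If $\mathrm{sh}(G_w)$ is symmetric, then the poset $\mathbb L_w$ is (rank-)symmetric. (b) If either $n-1$ is odd and $\mathrm{sh}(G_w)$ is symmetric, or $n-1$ is even and $\mathrm{sh}(G_w)$ is self-conjugate, then the poset $\mathbb P_w$ is (rank-)symmetric.
   Context: Words are strings over $\{a,b\}$; $a^*=b$, $b^*=a$; the dual word of $w=w_1\cdots w_{n-1}$ is $w^*=w_1^*w_2w_3^*w_4\cdots$. Let $w^\circ=w_{n-1}w_{n-2}\cdots w_1$ and $\overline w=w_{n-1}^*w_{n-2}^*\cdots w_1^*$. A word is symmetric if $w^\circ=w$, and self-conjugate if $\overline w=w$. A snake graph with $n$ tiles consists of unit squares $T_1,\dots,T_n$ in $\mathbb Z^2$, each $T_{i+1}$ glued directly to the right of or directly above $T_i$. Its shape is the word of length $n-1$ whose $i$-th letter is $a$ (resp. $b$) if $T_{i+1}$ is right of (resp. above) $T_i$. $G_w$ is the snake graph of shape $w^*$. $\mathbb L_w$: lattice paths on $G_w$ (unit steps right or up along edges, from the SW vertex of $T_1$ to the NE vertex of $T_n$), with $L_2$ covering $L_1$ iff $L_2$ is obtained by replacing the S and E edges of a tile by its W and N edges. $\mathbb P_w$: perfect matchings of $G_w$;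 the minimal one uses only boundary edges (edges not shared by two tiles) and contains the S edge of $T_1$; $P_2$ covers $P_1$ iff $P_2$ is obtained by an up-twist at some $T_i$, i.e. replacing two opposite edges of $T_i$ in $P_1$ by the other two, horizontal replaced by vertical if $i$ is odd, vertical by horizontal if $i$ is even. $D_w$ is the lattice of order ideals of the poset on $\{1,\dots,n\}$ with covers $i+1\lessdot i$ if $w_i=a$ and $i\lessdot i+1$ if $w_i=b$. These are graded of rank $n$; a graded poset of rank $n$ is symmetric if its numbers $r_i$ of elements of rank $i$ satisfy $r_{n-i}=r_i$ for all $i$. *)

theory Defs
  imports Main
begin

datatype letter = A | B

type_synonym word = "letter list"

fun star :: "letter \<Rightarrow> letter" where
  "star A = B"
| "star B = A"

text \<open>Lists are indexed from 0, so the letters in odd position of a word are those of even index.\<close>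

definition dual :: "word \<Rightarrow> word" where
  "dual w = map (\<lambda>i. if even i then star (w ! i) else w ! i) [0..<length w]"

definition conjugate :: "word \<Rightarrow> word" where
  "conjugate w = map star (rev w)"

definition symmetric_word :: "word \<Rightarrow> bool" where
  "symmetric_word w \<longleftrightarrow> rev w = w"

definition self_conjugate :: "word \<Rightarrow> bool" where
  "self_conjugate w \<longleftrightarrow> conjugate w = w"

type_synonym vertex = "int \<times> int"
type_synonym edge = "vertex set"

definition right :: "vertex \<Rightarrow> vertex" where
  "right p = (fst p + 1, snd p)"

definition above :: "vertex \<Rightarrow> vertex" where
  "above p = (fst p, snd p + 1)"

text \<open>
  A tile is identified with its south-west corner, so that \<^term>\<open>right t\<close> and \<^term>\<open>above t\<close>
  are also the tiles glued to \<^term>\<open>t\<close> on its right and on top of it.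
\<close>

type_synonym tile = vertex

definition south :: "tile \<Rightarrow> edge" where
  "south t = {t, right t}"

definition north :: "tile \<Rightarrow> edge" where
  "north t = {above t, above (right t)}"

definition west :: "tile \<Rightarrow> edge" where
  "west t = {t, above t}"

definition east :: "tile \<Rightarrow> edge" where
  "east t = {right t, above (right t)}"

text \<open>
  A snake graph is given by its list of tiles; \<open>G ! i\<close> is the tile \<open>T\<^sub>i\<^sub>+\<^sub>1\<close>.
  Snake graphs of a given shape differ by a translation only; the first tile is put at the origin.
\<close>

type_synonym snake_graph = "tile list"

fun tiles_from :: "tile \<Rightarrow> word \<Rightarrow> snake_graph" where
  "tiles_from t [] = [t]"
| "tiles_from t (A # v) = t # tiles_from (right t) v"
| "tiles_from t (B # v) = t # tiles_from (above t) v"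

definition snake :: "word \<Rightarrow> snake_graph" where
  "snake v = tiles_from (0, 0) v"

definition shape :: "snake_graph \<Rightarrow> word" where
  "shape G = map (\<lambda>i. if G ! Suc i = right (G ! i) then A else B) [0..<length G - 1]"

definition snake_of :: "word \<Rightarrow> snake_graph" where
  "snake_of w = snake (dual w)"

definition vertices :: "snake_graph \<Rightarrow> vertex set" where
  "vertices G = (\<Union>t\<in>set G. {t, right t, above t, above (right t)})"

definition edges :: "snake_graph \<Rightarrow> edge set" where
  "edges G = (\<Union>t\<in>set G. {south t, east t, north t, west t})"

text \<open>A poset is given by its order relation; the set of its elements is the field of the relation.\<close>

definition covered_by :: "'a rel \<Rightarrow> 'a \<Rightarrow> 'a \<Rightarrow> bool" where
  "covered_by r x y \<longleftrightarrow>
     (x, y) \<in> r \<and> x \<noteq> y \<and> (\<forall>z. (x, z) \<in> r \<and> (z, y) \<in> r \<longrightarrow> z = x \<or> z = y)"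

definition minimal_in :: "'a rel \<Rightarrow> 'a \<Rightarrow> bool" where
  "minimal_in r x \<longleftrightarrow> x \<in> Field r \<and> (\<forall>y. (y, x) \<in> r \<longrightarrow> y = x)"

definition maximal_in :: "'a rel \<Rightarrow> 'a \<Rightarrow> bool" where
  "maximal_in r x \<longleftrightarrow> x \<in> Field r \<and> (\<forall>y. (x, y) \<in> r \<longrightarrow> y = x)"

text \<open>
  \<open>graded_by r n \<rho>\<close>: the finite poset \<open>r\<close> is graded of rank \<open>n\<close>, that is, all its maximal chains
  have length \<open>n\<close>, and \<open>\<rho>\<close> is its rank function (unique on the elements of the poset).
\<close>

definition graded_by :: "'a rel \<Rightarrow> nat \<Rightarrow> ('a \<Rightarrow> nat) \<Rightarrow> bool" where
  "graded_by r n \<rho> \<longleftrightarrow>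
     finite (Field r) \<and> Partial_order r \<and>
     (\<forall>x. minimal_in r x \<longrightarrow> \<rho> x = 0) \<and>
     (\<forall>x y. covered_by r x y \<longrightarrow> \<rho> y = Suc (\<rho> x)) \<and>
     (\<forall>x. maximal_in r x \<longrightarrow> \<rho> x = n)"

definition rank_number :: "'a rel \<Rightarrow> ('a \<Rightarrow> nat) \<Rightarrow> nat \<Rightarrow> nat" where
  "rank_number r \<rho> i = card {x \<in> Field r. \<rho> x = i}"

definition rank_symmetric :: "'a rel \<Rightarrow> nat \<Rightarrow> bool" where
  "rank_symmetric r n \<longleftrightarrow>
     (\<exists>\<rho>. graded_by r n \<rho> \<and> (\<forall>i\<le>n. rank_number r \<rho> (n - i) = rank_number r \<rho> i))"

text \<open>The order on \<open>X\<close> generated by a relation \<open>c\<close> on \<open>X\<close>, the intended covering relation.\<close>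

definition generated_order :: "'a set \<Rightarrow> 'a rel \<Rightarrow> 'a rel" where
  "generated_order X c = {(x, y). x \<in> X \<and> y \<in> X \<and> (x, y) \<in> c\<^sup>*}"

text \<open>A lattice path is the list of the vertices it visits.\<close>

type_synonym path = "vertex list"

definition path_edges :: "path \<Rightarrow> edge set" where
  "path_edges p = {{p ! i, p ! Suc i} | i. Suc i < length p}"

definition lattice_paths :: "snake_graph \<Rightarrow> path set" where
  "lattice_paths G = {p.
     p \<noteq> [] \<and> hd p = hd G \<and> last p = above (right (last G)) \<and>
     (\<forall>i. Suc i < length p \<longrightarrow> p ! Suc i = right (p ! i) \<or> p ! Suc i = above (p ! i)) \<and>
     path_edges p \<subseteq> edges G}"

definition path_covers :: "snake_graph \<Rightarrow> path rel" where
  "path_covers G = {(p, q).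
     p \<in> lattice_paths G \<and> q \<in> lattice_paths G \<and>
     (\<exists>t\<in>set G. {south t, east t} \<subseteq> path_edges p \<and>
        path_edges q = path_edges p - {south t, east t} \<union> {west t, north t})}"

definition path_poset :: "word \<Rightarrow> path rel" where
  "path_poset w = generated_order (lattice_paths (snake_of w)) (path_covers (snake_of w))"

type_synonym matching = "edge set"

definition perfect_matchings :: "snake_graph \<Rightarrow> matching set" where
  "perfect_matchings G = {M. M \<subseteq> edges G \<and> (\<forall>v\<in>vertices G. \<exists>!e. e \<in> M \<and> v \<in> e)}"

text \<open>\<open>G ! i\<close> is \<open>T\<^sub>i\<^sub>+\<^sub>1\<close>, so \<open>i\<close> even means a tile in odd position.\<close>

definition up_twist :: "snake_graph \<Rightarrow> nat \<Rightarrow> matching \<Rightarrow> matching \<Rightarrow> bool" where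
  "up_twist G i M N \<longleftrightarrow>
     (let h = {south (G ! i), north (G ! i)}; v = {west (G ! i), east (G ! i)}
      in if even i then h \<subseteq> M \<and> N = M - h \<union> v else v \<subseteq> M \<and> N = M - v \<union> h)"

text \<open>
  The minimal perfect matching need not be singled out: with this parity of the twists, the
  matching by boundary edges that contains the south edge of the first tile is the least one.
\<close>

definition matching_covers :: "snake_graph \<Rightarrow> matching rel" where
  "matching_covers G = {(M, N).
     M \<in> perfect_matchings G \<and> N \<in> perfect_matchings G \<and> (\<exists>i<length G. up_twist G i M N)}"

definition matching_poset :: "word \<Rightarrow> matching rel" where
  "matching_poset w =
     generated_order (perfect_matchings (snake_of w)) (matching_covers (snake_of w))"

end

theory Submission
  imports Defs
begin

text \<open>
  Both lattices are lattices of order ideals of a fence (a zigzag poset on the tiles), and their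
  rank symmetry comes from an order-reversing symmetry of that fence.

  The antidiagonals \<open>x + y = k\<close> cut a snake graph with \<open>n\<close> tiles into levels. The levels \<open>0\<close> and
  \<open>n + 1\<close> contain one vertex each, every level in between contains exactly two, the south-east and
  the north-west corner of one tile, and every edge joins two consecutive levels. A lattice path
  has one edge between any two consecutive levels, and consecutive edges share a vertex.
  The same count holds for a perfect matching: going up level by level, one of the two vertices of
  an inner level is already matched downwards, so exactly the other one is matched upwards
  (\<open>perfect_matching_is_strands\<close>). Hence a matching also has one edge between any two
  consecutive levels, but consecutive edges have complementary endpoints.

  Either object is therefore encoded by a set \<open>I\<close> of tiles, with one bit per inner level. For a
  path, the bit says which of the two vertices is visited. For a matching the bit is read
  with a sign that changes from one edge to the next; this turns complementary endpoints into equal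
  bits. The chosen vertices are joined by edges of the graph iff \<open>I\<close> is an order ideal of the fence
  given by a word: the shape \<open>v\<close> for paths, and \<open>dual v\<close> for matchings, since the alternating signs
  reverse every second relation (\<open>fence_ideals_twisted\<close>). The covering moves at the \<open>i\<close>-th tile are
  exactly the insertions of \<open>i\<close> into \<open>I\<close> (\<open>flips_iff_insert\<close>), so the rank is the cardinality of \<open>I\<close>.

  If the word of the fence is a palindrome, taking the mirror image of the complement maps ideals
  with \<open>k\<close> elements to ideals with \<open>n - k\<close> elements (\<open>rank_symmetric_of_fence\<close>). For paths this word
  is the shape. For matchings, the dual of the shape is a palindrome when the shape has odd length
  and is symmetric, or has even length and is self-conjugate, because the positions \<open>i\<close> and \<open>n - i\<close>
  have the same parity in the first case and opposite parities in the second.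
\<close>

section \<open>Gradings of generated orders\<close>

lemma Field_generated_order: "Field (generated_order X c) = X"
  by (auto simp: generated_order_def Field_def)

text \<open>
  A function that grows by one along \<open>c\<close> makes every generating pair a cover, and every cover of
  the generated order is a single step of \<open>c\<close>. So \<open>c\<close> is the covering relation, and
  minimal and maximal elements are those that \<open>c\<close> does not lead to or does not leave.
\<close>

lemma graded_by_generated_order:
  assumes fin: "finite X"
    and cX: "c \<subseteq> X \<times> X"
    and up: "\<And>x y. (x, y) \<in> c \<Longrightarrow> \<rho> y = Suc (\<rho> x)"
    and below: "\<And>x. x \<in> X \<Longrightarrow> \<rho> x \<noteq> 0 \<Longrightarrow> \<exists>y. (y, x) \<in> c"
    and beyond: "\<And>x. x \<in> X \<Longrightarrow> \<rho> x \<noteq> n \<Longrightarrow> \<exists>y. (x, y) \<in> c"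
  shows "graded_by (generated_order X c) n \<rho>"
proof -
  let ?r = "generated_order X c"
  have mono: "x = y \<or> \<rho> x < \<rho> y" if "(x, y) \<in> c\<^sup>*" for x y
    using that by (induction rule: rtrancl_induct) (auto dest: up)
  have gen: "(x, y) \<in> ?r" if "(x, y) \<in> c" for x y
    using that cX by (auto simp: generated_order_def)
  have "Partial_order ?r"
    unfolding partial_order_on_def preorder_on_def
  proof (intro conjI)
    show "Refl ?r"
      unfolding refl_on_def Field_generated_order by (auto simp: generated_order_def)
    show "trans ?r" by (auto simp: trans_def generated_order_def)
    show "antisym ?r" by (auto simp: antisym_def generated_order_def dest!: mono)
  qed (auto simp: Field_def)
  moreover have "\<rho> x = 0" if "minimal_in ?r x" for x
  proof (rule ccontr)
    assume "\<rho> x \<noteq> 0"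
    moreover have "x \<in> X" using that by (simp add: minimal_in_def Field_generated_order)
    ultimately obtain y where "(y, x) \<in> c" using below by blast
    then show False using that gen up by (fastforce simp: minimal_in_def)
  qed
  moreover have "\<rho> x = n" if "maximal_in ?r x" for x
  proof (rule ccontr)
    assume "\<rho> x \<noteq> n"
    moreover have "x \<in> X" using that by (simp add: maximal_in_def Field_generated_order)
    ultimately obtain y where "(x, y) \<in> c" using beyond by blast
    then show False using that gen up by (fastforce simp: maximal_in_def)
  qed
  moreover have "\<rho> y = Suc (\<rho> x)" if cov: "covered_by ?r x y" for x y
  proof -
    have "(x, y) \<in> c\<^sup>*" "x \<noteq> y" "y \<in> X"
      using cov by (auto simp: covered_by_def generated_order_def)
    then obtain z where z: "(x, z) \<in> c" "(z, y) \<in> c\<^sup>*"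
      by (meson converse_rtranclE)
    then have "(x, z) \<in> ?r" "(z, y) \<in> ?r"
      using cX \<open>y \<in> X\<close> gen by (auto simp: generated_order_def)
    then have "z = x \<or> z = y" using cov by (auto simp: covered_by_def)
    then show ?thesis using up[OF z(1)] by auto
  qed
  ultimately show ?thesis
    using fin by (auto simp: graded_by_def Field_generated_order)
qed

section \<open>Order ideals of a fence\<close>

definition fence_ideals :: "word \<Rightarrow> nat set set" where
  "fence_ideals u = {I. I \<subseteq> {..length u} \<and>
     (\<forall>i<length u. if u ! i = A then i \<in> I \<longrightarrow> Suc i \<in> I else Suc i \<in> I \<longrightarrow> i \<in> I)}"

text \<open>
  A strictly monotone integer-valued function on the fence: it guarantees extremal elements, and
  thus ideals that differ by one element, without analysing the zigzag.
\<close>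

definition fence_height :: "word \<Rightarrow> nat \<Rightarrow> int" where
  "fence_height u i = (\<Sum>j<i. if u ! j = A then - 1 else 1)"

text \<open>
  An element of greatest height in an ideal is maximal in it, so the rest is again an ideal.
\<close>

lemma fence_ideal_remove:
  assumes I: "I \<in> fence_ideals u" and "I \<noteq> {}"
  shows "\<exists>i\<in>I. I - {i} \<in> fence_ideals u"
proof -
  have "finite I" using I by (auto simp: fence_ideals_def intro: finite_subset)
  then have "Max (fence_height u ` I) \<in> fence_height u ` I" using \<open>I \<noteq> {}\<close> by simp
  then obtain i where i: "i \<in> I" "fence_height u i = Max (fence_height u ` I)"
    by (metis imageE)
  have top: "fence_height u j \<le> fence_height u i" if "j \<in> I" for j
    using that i \<open>finite I\<close> by simp
  have "I - {i} \<in> fence_ideals u"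
    using I top[of "Suc i"] top[of "i - 1"]
    by (fastforce simp: fence_ideals_def fence_height_def split: if_splits)
  then show ?thesis using i by blast
qed

lemma fence_ideal_insert:
  assumes I: "I \<in> fence_ideals u" and "I \<noteq> {..length u}"
  shows "\<exists>i. i \<notin> I \<and> insert i I \<in> fence_ideals u"
proof -
  let ?C = "{..length u} - I"
  have "?C \<noteq> {}" using assms by (auto simp: fence_ideals_def)
  then have "Min (fence_height u ` ?C) \<in> fence_height u ` ?C" by (intro Min_in) simp_all
  then obtain i where i: "i \<in> ?C" "fence_height u i = Min (fence_height u ` ?C)"
    by (metis imageE)
  have bot: "fence_height u i \<le> fence_height u j" if "j \<in> ?C" for j
    using that i by simp
  have "insert i I \<in> fence_ideals u"
    using I bot[of "Suc i"] bot[of "i - 1"] i(1)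
    by (fastforce simp: fence_ideals_def fence_height_def split: if_splits)
  then show ?thesis using i by blast
qed

lemma finite_fence_ideals: "finite (fence_ideals u)"
  by (rule finite_subset[of _ "Pow {..length u}"]) (auto simp: fence_ideals_def)

text \<open>
  The complement of the mirror image of \<open>I\<close> under \<open>i \<mapsto> m - i\<close>.
\<close>

definition reflect :: "nat \<Rightarrow> nat set \<Rightarrow> nat set" where
  "reflect m I = {i. i \<le> m \<and> m - i \<notin> I}"

lemma reflect_reflect: "I \<subseteq> {..m} \<Longrightarrow> reflect m (reflect m I) = I"
  by (auto simp: reflect_def)

lemma card_reflect:
  assumes "I \<subseteq> {..m}"
  shows "card (reflect m I) = Suc m - card I"
proof -
  have "card (reflect m I) = card ({..m} - I)"
    by (rule bij_betw_same_card[of "\<lambda>i. m - i"], rule bij_betw_byWitness[of _ "\<lambda>i. m - i"])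
       (auto simp: reflect_def)
  then show ?thesis using assms by (simp add: card_Diff_subset finite_subset)
qed

text \<open>
  For a palindrome the mirror map reverses the order of the fence: a relation between \<open>i\<close> and
  \<open>i + 1\<close> goes to the relation of the same type between \<open>m - i - 1\<close> and \<open>m - i\<close>. It
  turns ideals into filters, and complementation turns filters back into ideals.
\<close>

lemma reflect_fence_ideal:
  assumes sym: "rev u = u" and I: "I \<in> fence_ideals u"
  shows "reflect (length u) I \<in> fence_ideals u"
proof -
  have "if u ! i = A then i \<in> reflect (length u) I \<longrightarrow> Suc i \<in> reflect (length u) I
        else Suc i \<in> reflect (length u) I \<longrightarrow> i \<in> reflect (length u) I" if i: "i < length u" for i
  proof -
    let ?j = "length u - Suc i"
    have "u ! i = u ! ?j" using sym i by (metis rev_nth)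
    moreover have "if u ! ?j = A then ?j \<in> I \<longrightarrow> Suc ?j \<in> I else Suc ?j \<in> I \<longrightarrow> ?j \<in> I"
      using I i by (simp add: fence_ideals_def)
    moreover have "Suc ?j = length u - i" using i by auto
    ultimately show ?thesis using i by (auto simp: reflect_def split: if_splits)
  qed
  moreover have "reflect (length u) I \<subseteq> {..length u}" by (auto simp: reflect_def)
  ultimately show ?thesis unfolding fence_ideals_def by blast
qed

lemma rank_symmetric_of_fence:
  fixes u :: word and f :: "nat set \<Rightarrow> 'a"
  assumes sym: "rev u = u"
    and inj: "inj_on f (fence_ideals u)"
    and X: "X = f ` fence_ideals u"
    and cX: "c \<subseteq> X \<times> X"
    and c: "\<And>I J. I \<in> fence_ideals u \<Longrightarrow> J \<in> fence_ideals u \<Longrightarrow>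
               (f I, f J) \<in> c \<longleftrightarrow> (\<exists>i. i \<notin> I \<and> J = insert i I)"
  shows "rank_symmetric (generated_order X c) (Suc (length u))"
proof -
  define \<rho> where "\<rho> x = card (the_inv_into (fence_ideals u) f x)" for x
  have \<rho>: "\<rho> (f I) = card I" if "I \<in> fence_ideals u" for I
    using that inj by (simp add: \<rho>_def the_inv_into_f_f)
  have sub: "I \<subseteq> {..length u}" and finI: "finite I" if "I \<in> fence_ideals u" for I
    using that by (auto simp: fence_ideals_def intro: finite_subset)
  have "graded_by (generated_order X c) (Suc (length u)) \<rho>"
  proof (rule graded_by_generated_order)
    show "finite X" using X finite_fence_ideals by simp
    show "c \<subseteq> X \<times> X" by (fact cX)
    show "\<rho> y = Suc (\<rho> x)" if "(x, y) \<in> c" for x y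
    proof -
      have "x \<in> X" "y \<in> X" using that cX by blast+
      then obtain I J where IJ: "I \<in> fence_ideals u" "J \<in> fence_ideals u" "x = f I" "y = f J"
        unfolding X by blast
      then show ?thesis using that c[of I J] \<rho> finI by auto
    qed
    show "\<exists>y. (y, x) \<in> c" if xX: "x \<in> X" and x: "\<rho> x \<noteq> 0" for x
    proof -
      obtain I where I: "I \<in> fence_ideals u" "x = f I" using xX unfolding X by blast
      then have "I \<noteq> {}" using x \<rho> by auto
      then obtain i where "i \<in> I" "I - {i} \<in> fence_ideals u"
        using fence_ideal_remove I by blast
      then have "(f (I - {i}), x) \<in> c" using c[of "I - {i}" I] I by auto
      then show ?thesis by blast
    qed
    show "\<exists>y. (x, y) \<in> c" if xX: "x \<in> X" and x: "\<rho> x \<noteq> Suc (length u)" for x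
    proof -
      obtain I where I: "I \<in> fence_ideals u" "x = f I" using xX unfolding X by blast
      then have "I \<noteq> {..length u}" using x \<rho> by auto
      then obtain i where "i \<notin> I" "insert i I \<in> fence_ideals u"
        using fence_ideal_insert I by blast
      then have "(x, f (insert i I)) \<in> c" using c[of I "insert i I"] I by auto
      then show ?thesis by blast
    qed
  qed
  moreover have "rank_number (generated_order X c) \<rho> (Suc (length u) - k)
      = rank_number (generated_order X c) \<rho> k" if k: "k \<le> Suc (length u)" for k
  proof -
    have num: "rank_number (generated_order X c) \<rho> j = card {I \<in> fence_ideals u. card I = j}" for j
    proof -
      have "{x \<in> X. \<rho> x = j} = f ` {I \<in> fence_ideals u. card I = j}"
        using X \<rho> by auto
      moreover have "inj_on f {I \<in> fence_ideals u. card I = j}"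
        using inj by (rule inj_on_subset) auto
      ultimately show ?thesis
        by (simp add: rank_number_def Field_generated_order card_image)
    qed
    have le: "card I \<le> Suc (length u)" if "I \<in> fence_ideals u" for I
      using card_mono[OF _ sub[OF that]] by simp
    show ?thesis unfolding num
    proof (rule bij_betw_same_card[of "reflect (length u)"],
        rule bij_betw_byWitness[of _ "reflect (length u)"])
      let ?R = "reflect (length u)"
      show "\<forall>I\<in>{I \<in> fence_ideals u. card I = Suc (length u) - k}. ?R (?R I) = I"
        "\<forall>I\<in>{I \<in> fence_ideals u. card I = k}. ?R (?R I) = I"
        using sub by (auto simp: reflect_reflect)
      show "?R ` {I \<in> fence_ideals u. card I = Suc (length u) - k} \<subseteq> {I \<in> fence_ideals u. card I = k}"
        "?R ` {I \<in> fence_ideals u. card I = k} \<subseteq> {I \<in> fence_ideals u. card I = Suc (length u) - k}"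
        using sub k by (auto simp: reflect_fence_ideal[OF sym] card_reflect)
    qed
  qed
  ultimately show ?thesis by (auto simp: rank_symmetric_def)
qed

section \<open>The vertices of a snake graph, level by level\<close>

abbreviation tile_at :: "word \<Rightarrow> nat \<Rightarrow> tile" where
  "tile_at v i \<equiv> snake v ! i"

lemma length_tiles_from [simp]: "length (tiles_from t v) = Suc (length v)"
  by (induction t v rule: tiles_from.induct) auto

lemma length_snake [simp]: "length (snake v) = Suc (length v)"
  by (simp add: snake_def)

lemma tiles_from_0: "tiles_from t v ! 0 = t"
  by (cases "(t, v)" rule: tiles_from.cases) auto

lemma tile_at_0 [simp]: "tile_at v 0 = (0, 0)"
  by (simp add: snake_def tiles_from_0)

lemma tiles_from_Suc: "i < length v \<Longrightarrow> tiles_from t v ! Suc i =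
    (if v ! i = A then right (tiles_from t v ! i) else above (tiles_from t v ! i))"
proof (induction t v arbitrary: i rule: tiles_from.induct)
  case (2 t v) then show ?case by (cases i) (auto simp: tiles_from_0)
next
  case (3 t v) then show ?case by (cases i) (auto simp: tiles_from_0)
qed auto

lemma tile_at_Suc: "i < length v \<Longrightarrow>
    tile_at v (Suc i) = (if v ! i = A then right (tile_at v i) else above (tile_at v i))"
  by (simp add: snake_def tiles_from_Suc)

lemma shape_snake: "shape (snake v) = v"
proof (rule nth_equalityI)
  fix i assume "i < length (shape (snake v))"
  then have i: "i < length v" by (simp add: shape_def)
  then show "shape (snake v) ! i = v ! i"
    by (cases "v ! i") (auto simp: shape_def tile_at_Suc right_def above_def)
qed (simp add: shape_def)

definition level :: "vertex \<Rightarrow> int" where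
  "level p = fst p + snd p"

lemma level_right [simp]: "level (right p) = level p + 1"
  and level_above [simp]: "level (above p) = level p + 1"
  by (simp_all add: level_def right_def above_def)

lemma level_tile_at [simp]: "i \<le> length v \<Longrightarrow> level (tile_at v i) = int i"
  by (induction i) (auto simp: tile_at_Suc, simp add: level_def)

text \<open>
  The two vertices of a tile that lie on the same antidiagonal; the truth value selects the
  north-west one.
\<close>

definition corner :: "word \<Rightarrow> nat \<Rightarrow> bool \<Rightarrow> vertex" where
  "corner v i x = (if x then above (tile_at v i) else right (tile_at v i))"

definition far_corner :: "word \<Rightarrow> nat \<Rightarrow> vertex" where
  "far_corner v i = above (right (tile_at v i))"

text \<open>
  The vertices of level \<open>k\<close>. The truth value chooses between the two vertices of an inner level;
  the first and the last level consist of a single vertex, which both values denote.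
\<close>

fun node :: "word \<Rightarrow> nat \<Rightarrow> bool \<Rightarrow> vertex" where
  "node v 0 x = tile_at v 0"
| "node v (Suc i) x = (if i \<le> length v then corner v i x else far_corner v (length v))"

lemma level_node: "k \<le> length v + 2 \<Longrightarrow> level (node v k x) = int k"
proof (cases k)
  case 0 then show ?thesis by (simp add: level_def)
next
  case (Suc i)
  assume "k \<le> length v + 2"
  then have "i \<le> length v \<or> i = Suc (length v)" using Suc by auto
  then show ?thesis using Suc by (auto simp: corner_def far_corner_def)
qed

lemma corner_eq_iff [simp]: "corner v i x = corner v i y \<longleftrightarrow> x = y"
  by (auto simp: corner_def right_def above_def prod_eq_iff)

definition step :: "vertex \<Rightarrow> vertex \<Rightarrow> bool" where
  "step p q \<longleftrightarrow> q = right p \<or> q = above p"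

lemma step_level: "step p q \<Longrightarrow> level q = level p + 1"
  by (auto simp: step_def)

lemma step_first: "step (node v 0 x) (node v (Suc 0) y)"
  by (auto simp: step_def corner_def)

lemma step_last: "step (node v (Suc (length v)) x) (node v (Suc (Suc (length v))) y)"
  by (auto simp: step_def corner_def far_corner_def right_def above_def)

text \<open>
  Of the four pairs of vertices on two consecutive inner levels, three are at distance one. If the
  next tile is on the right, its south-east corner is too far from the current north-west corner;
  if it is on top, the roles are exchanged. This is the source of the fence relation.
\<close>

lemma step_node_iff:
  "i < length v \<Longrightarrow> step (node v (Suc i) x) (node v (Suc (Suc i)) y) \<longleftrightarrow>
     (if v ! i = A then x \<longrightarrow> y else y \<longrightarrow> x)"
  by (auto simp: step_def corner_def tile_at_Suc right_def above_def prod_eq_iff)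

lemma tile_at_node: "i \<le> length v \<Longrightarrow> \<exists>x. tile_at v i = node v i x"
proof (cases i)
  case (Suc j)
  assume "i \<le> length v"
  then show ?thesis using Suc by (intro exI[of _ "v ! j \<noteq> A"]) (auto simp: tile_at_Suc corner_def)
qed auto

lemma far_corner_node: "i \<le> length v \<Longrightarrow> \<exists>x. far_corner v i = node v (Suc (Suc i)) x"
proof (cases "i = length v")
  case False
  assume "i \<le> length v"
  then show ?thesis using False
    by (intro exI[of _ "v ! i = A"])
       (auto simp: tile_at_Suc corner_def far_corner_def right_def above_def)
qed auto

lemma set_snake: "set (snake v) = tile_at v ` {..length v}"
  by (auto simp: set_conv_nth image_iff less_Suc_eq_le)

text \<open>
  The south-west vertex of a tile is an antidiagonal corner of the preceding tile, and its
  north-east vertex is one of the following tile. So only the two ends of the snake contribute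
  vertices besides the antidiagonal corners.
\<close>

lemma vertices_snake: "vertices (snake v) = {node v k x | k x. k \<le> length v + 2}"
proof
  show "vertices (snake v) \<subseteq> {node v k x | k x. k \<le> length v + 2}"
  proof
    fix p assume "p \<in> vertices (snake v)"
    then obtain i where i: "i \<le> length v"
      and p: "p = tile_at v i \<or> p = far_corner v i \<or> p = corner v i True \<or> p = corner v i False"
      by (auto simp: vertices_def set_snake far_corner_def corner_def)
    have "corner v i x = node v (Suc i) x" for x using i by simp
    with p obtain k x where "k \<le> i + 2" "p = node v k x"
      using tile_at_node[OF i] far_corner_node[OF i]
      by (metis add_2_eq_Suc' le_add1 le_refl le_SucI)
    then show "p \<in> {node v k x | k x. k \<le> length v + 2}" using i by fastforce
  qed
next
  show "{node v k x | k x. k \<le> length v + 2} \<subseteq> vertices (snake v)"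
  proof
    fix p assume "p \<in> {node v k x | k x. k \<le> length v + 2}"
    then obtain k x where "k \<le> length v + 2" "p = node v k x" by blast
    then show "p \<in> vertices (snake v)"
      by (cases k) (force simp: vertices_def set_snake corner_def far_corner_def)+
  qed
qed

lemma vertex_levelE:
  assumes "p \<in> vertices (snake v)" "level p = int k"
  obtains x where "p = node v k x" "k \<le> length v + 2"
  using assms by (auto simp: vertices_snake level_node)

lemma tile_edges:
  "south (tile_at v i) = {tile_at v i, corner v i False}"
  "west (tile_at v i) = {tile_at v i, corner v i True}"
  "east (tile_at v i) = {corner v i False, far_corner v i}"
  "north (tile_at v i) = {corner v i True, far_corner v i}"
  by (auto simp: south_def west_def east_def north_def corner_def far_corner_def)

lemma step_levelE:
  assumes "p \<in> vertices (snake v)" "q \<in> vertices (snake v)" "step p q"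
  obtains k x y where "k \<le> Suc (length v)" "p = node v k x" "q = node v (Suc k) y"
proof -
  obtain k x where k: "p = node v k x" "k \<le> length v + 2"
    using assms(1) by (auto simp: vertices_snake)
  then have "level q = int (Suc k)" using step_level[OF assms(3)] level_node[of k v x] by simp
  then obtain y where "q = node v (Suc k) y" "Suc k \<le> length v + 2"
    using assms(2) vertex_levelE by blast
  then show ?thesis using that[of k x y] k by simp
qed

text \<open>
  A snake graph is an induced subgraph of the square grid, so that whether an edge is present can be
  decided from its endpoints. For two inner levels, the three unit segments are the edge shared by
  two successive tiles and one further edge of each of them.
\<close>

lemma edges_snake:
  "edges (snake v) = {{p, q} | p q. p \<in> vertices (snake v) \<and> q \<in> vertices (snake v) \<and> step p q}"
proof (intro equalityI subsetI)
  fix e assume "e \<in> edges (snake v)"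
  then obtain i where i: "i \<le> length v"
    and "e \<in> {south (tile_at v i), east (tile_at v i), north (tile_at v i), west (tile_at v i)}"
    by (auto simp: edges_def set_snake)
  moreover have "tile_at v i \<in> vertices (snake v)" "far_corner v i \<in> vertices (snake v)"
    "corner v i x \<in> vertices (snake v)" for x
    using i by (auto simp: vertices_def set_snake far_corner_def corner_def)
  moreover have "step (tile_at v i) (corner v i x)" "step (corner v i x) (far_corner v i)" for x
    by (auto simp: step_def corner_def far_corner_def right_def above_def)
  ultimately show "e \<in> {{p, q} | p q. p \<in> vertices (snake v) \<and> q \<in> vertices (snake v) \<and> step p q}"
    unfolding tile_edges by blast
next
  fix e assume "e \<in> {{p, q} | p q. p \<in> vertices (snake v) \<and> q \<in> vertices (snake v) \<and> step p q}"
  then obtain p q where pq: "e = {p, q}" "p \<in> vertices (snake v)" "q \<in> vertices (snake v)" "step p q"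
    by blast
  then obtain k x y where k: "k \<le> Suc (length v)" and p: "p = node v k x" and q: "q = node v (Suc k) y"
    using step_levelE by metis
  have edge: "{south (tile_at v i), east (tile_at v i), north (tile_at v i), west (tile_at v i)}
      \<subseteq> edges (snake v)" if "i \<le> length v" for i
    using that by (auto simp: edges_def set_snake)
  consider "k = 0" | "k = Suc (length v)" | i where "k = Suc i" "i < length v"
    using k by (cases k) (auto, linarith)
  then show "e \<in> edges (snake v)"
  proof cases
    case 1
    then have "e = south (tile_at v 0) \<or> e = west (tile_at v 0)"
      using pq p q unfolding tile_edges by (cases y) auto
    then show ?thesis using edge[of 0] by auto
  next
    case 2
    then have "e = east (tile_at v (length v)) \<or> e = north (tile_at v (length v))"
      using pq p q unfolding tile_edges by (cases x) auto
    then show ?thesis using edge[of "length v"] by auto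
  next
    case (3 i)
    then have "e \<in> {east (tile_at v i), north (tile_at v i), south (tile_at v (Suc i)), west (tile_at v (Suc i))}"
      using pq p q step_node_iff[of i v x y]
      by (cases x; cases y; cases "v ! i = A")
         (auto simp: tile_at_Suc corner_def south_def east_def north_def west_def right_def above_def)
    then show ?thesis using edge[of i] edge[of "Suc i"] 3 by auto
  qed
qed

lemma doubleton_level_eq:
  assumes "{p, q} = {p', q'}" "level p = level p'" "level q = level q'" "level p \<noteq> level q"
  shows "p = p' \<and> q = q'"
  using assms by (auto simp: doubleton_eq_iff)

declare node.simps [simp del]

lemma level_pair_eq_iff: "{int k, int k + 1} = {int j, int j + 1} \<longleftrightarrow> k = j"
  by (auto simp: doubleton_eq_iff)

section \<open>Strands\<close>

text \<open>
  The edge between the levels \<open>k\<close> and \<open>k + 1\<close> chosen by \<open>I\<close>. An inner level \<open>k\<close> belongs to the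
  tile with index \<open>k - 1\<close>, and \<open>b k\<close> reverses the choice at both ends. The meaning at a level thus
  changes exactly where \<open>b\<close> does: a constant \<open>b\<close> makes consecutive edges meet, an alternating
  one makes them disjoint. The truncated difference at \<open>k = 0\<close> is harmless, because both truth values
  select the single vertex of level \<open>0\<close>.
\<close>

definition strand :: "word \<Rightarrow> (nat \<Rightarrow> bool) \<Rightarrow> nat set \<Rightarrow> nat \<Rightarrow> edge" where
  "strand v b I k = {node v k ((k - 1 \<in> I) \<noteq> b k), node v (Suc k) ((k \<in> I) \<noteq> b k)}"

definition strands :: "word \<Rightarrow> (nat \<Rightarrow> bool) \<Rightarrow> nat set \<Rightarrow> edge set" where
  "strands v b I = strand v b I ` {..Suc (length v)}"

text \<open>
  Reversing both bits that the edge \<open>i + 1\<close> depends on reverses the implication between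
  \<open>i \<in> I\<close> and \<open>i + 1 \<in> I\<close> that makes this edge present.
\<close>

definition twisted :: "(nat \<Rightarrow> bool) \<Rightarrow> word \<Rightarrow> word" where
  "twisted b v = map (\<lambda>i. if b (Suc i) then star (v ! i) else v ! i) [0..<length v]"

lemma length_twisted [simp]: "length (twisted b v) = length v"
  by (simp add: twisted_def)

lemma all_le_Suc_interior:
  assumes "P 0" "P (Suc n)"
  shows "(\<forall>k\<le>Suc n. P k) \<longleftrightarrow> (\<forall>i<n. P (Suc i))"
proof (intro iffI allI impI)
  fix k assume *: "\<forall>i<n. P (Suc i)" and "k \<le> Suc n"
  then consider "k = 0" | "k = Suc n" | i where "k = Suc i" "i < n"
    by (cases k) (auto, linarith)
  then show "P k" using assms * by cases auto
qed simp

lemma fence_ideals_twisted: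
  "I \<in> fence_ideals (twisted b v) \<longleftrightarrow> I \<subseteq> {..length v} \<and>
     (\<forall>k\<le>Suc (length v). step (node v k ((k - 1 \<in> I) \<noteq> b k)) (node v (Suc k) ((k \<in> I) \<noteq> b k)))"
  (is "_ \<longleftrightarrow> _ \<and> (\<forall>k\<le>_. ?S k)")
proof -
  have "(\<forall>k\<le>Suc (length v). ?S k) \<longleftrightarrow> (\<forall>i<length v. ?S (Suc i))"
    by (rule all_le_Suc_interior[of ?S]) (rule step_first step_last)+
  also have "\<dots> \<longleftrightarrow> (\<forall>i<length v. if twisted b v ! i = A then i \<in> I \<longrightarrow> Suc i \<in> I else Suc i \<in> I \<longrightarrow> i \<in> I)"
  proof (intro all_cong1 imp_cong refl)
    fix i assume i: "i < length v"
    show "?S (Suc i) = (if twisted b v ! i = A then i \<in> I \<longrightarrow> Suc i \<in> I else Suc i \<in> I \<longrightarrow> i \<in> I)"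
      unfolding step_node_iff[OF i] using i by (cases "v ! i") (auto simp: twisted_def)
  qed
  finally show ?thesis
    unfolding fence_ideals_def mem_Collect_eq length_twisted by (rule arg_cong[OF sym])
qed

lemma strand_eq_iff:
  assumes "k \<le> Suc (length v)"
  shows "strand v b I k = strand v b J k \<longleftrightarrow>
     node v k ((k - 1 \<in> I) \<noteq> b k) = node v k ((k - 1 \<in> J) \<noteq> b k) \<and>
     node v (Suc k) ((k \<in> I) \<noteq> b k) = node v (Suc k) ((k \<in> J) \<noteq> b k)"
  unfolding strand_def using assms
  by (auto dest!: doubleton_level_eq simp: level_node)

lemma level_strand:
  "k \<le> Suc (length v) \<Longrightarrow> level ` strand v b I k = {int k, int k + 1}"
  by (auto simp: strand_def level_node)

text \<open>
  The strands of a family lie between different pairs of levels, so an edge can only be the one on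
  its own levels.
\<close>

lemma mem_strands_iff:
  assumes "level ` e = {int k, int k + 1}" "k \<le> Suc (length v)"
  shows "e \<in> strands v b I \<longleftrightarrow> e = strand v b I k"
proof
  assume "e \<in> strands v b I"
  then obtain j where j: "j \<le> Suc (length v)" "e = strand v b I j"
    by (auto simp: strands_def)
  then have "{int k, int k + 1} = {int j, int j + 1}" using assms(1) level_strand by metis
  then show "e = strand v b I k" using j by (simp add: level_pair_eq_iff)
qed (use assms in \<open>auto simp: strands_def\<close>)

lemma strand_mem_upper:
  assumes "i \<le> length v" "strand v b I i = strand v b J i"
  shows "i \<in> I \<longleftrightarrow> i \<in> J"
  using assms by (auto simp: strand_eq_iff node.simps)

lemma strand_mem_lower:
  assumes "i \<le> length v" "strand v b I (Suc i) = strand v b J (Suc i)"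
  shows "i \<in> I \<longleftrightarrow> i \<in> J"
  using assms by (auto simp: strand_eq_iff node.simps)

lemma strands_inj:
  assumes "I \<subseteq> {..length v}" "J \<subseteq> {..length v}" "strands v b I = strands v b J"
  shows "I = J"
proof -
  have "i \<in> I \<longleftrightarrow> i \<in> J" if i: "i \<le> length v" for i
  proof (rule strand_mem_upper[OF i, of b])
    have "strand v b I i \<in> strands v b J"
      unfolding assms(3)[symmetric] using i by (simp add: strands_def)
    then show "strand v b I i = strand v b J i"
      using mem_strands_iff[of _ i v b J] level_strand[of i v b I] i by simp
  qed
  then show ?thesis using assms by blast
qed

definition near_edge :: "word \<Rightarrow> nat \<Rightarrow> bool \<Rightarrow> edge" where
  "near_edge v i x = {tile_at v i, corner v i x}"

definition far_edge :: "word \<Rightarrow> nat \<Rightarrow> bool \<Rightarrow> edge" where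
  "far_edge v i x = {corner v i x, far_corner v i}"

text \<open>
  The common form of the covering moves of paths and matchings at a tile: the edges of the tile
  next to its south-west vertex (\<open>near_edge\<close>) and next to its north-east vertex (\<open>far_edge\<close>) that
  the strands use when the tile is outside \<open>I\<close> are replaced by the two other edges.
\<close>

definition flips :: "word \<Rightarrow> (nat \<Rightarrow> bool) \<Rightarrow> nat \<Rightarrow> edge set \<Rightarrow> edge set \<Rightarrow> bool" where
  "flips v b i E F \<longleftrightarrow> {near_edge v i (b i), far_edge v i (b (Suc i))} \<subseteq> E \<and>
     F = E - {near_edge v i (b i), far_edge v i (b (Suc i))}
           \<union> {near_edge v i (\<not> b i), far_edge v i (\<not> b (Suc i))}"

lemma level_near_edge: "i \<le> length v \<Longrightarrow> level ` near_edge v i x = {int i, int i + 1}"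
  by (auto simp: near_edge_def corner_def)

lemma level_far_edge: "i \<le> length v \<Longrightarrow> level ` far_edge v i x = {int (Suc i), int (Suc i) + 1}"
  by (auto simp: far_edge_def corner_def far_corner_def)

lemma near_strand_mem:
  assumes "i \<le> length v" "strand v b I i = near_edge v i x"
  shows "x \<longleftrightarrow> (i \<in> I) \<noteq> b i"
proof -
  have "node v i ((i - 1 \<in> I) \<noteq> b i) = tile_at v i \<and> node v (Suc i) ((i \<in> I) \<noteq> b i) = corner v i x"
    using assms(2) unfolding strand_def near_edge_def
    by (rule doubleton_level_eq) (use assms(1) in \<open>auto simp: level_node corner_def\<close>)
  then show ?thesis using assms(1) by (auto simp: node.simps)
qed

text \<open>
  Only the strands \<open>i\<close> and \<open>i + 1\<close> change. The first one shows that \<open>i\<close> enters; any other bit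
  is visible in a strand that is untouched, namely at the upper end of strand \<open>j\<close>, or for \<open>j = i + 1\<close>
  at the lower end of strand \<open>j + 1\<close>.
\<close>

lemma flips_imp_insert:
  assumes i: "i \<le> length v" and I: "I \<subseteq> {..length v}" and J: "J \<subseteq> {..length v}"
    and flip: "flips v b i (strands v b I) (strands v b J)"
  shows "i \<notin> I \<and> J = insert i I"
proof -
  have "near_edge v i (b i) \<in> strands v b I" "near_edge v i (\<not> b i) \<in> strands v b J"
    using flip by (auto simp: flips_def)
  then have "strand v b I i = near_edge v i (b i)" "strand v b J i = near_edge v i (\<not> b i)"
    using mem_strands_iff[OF level_near_edge[OF i]] i by (metis le_SucI)+
  then have iIJ: "i \<notin> I" "i \<in> J" using near_strand_mem[OF i] by blast+
  have same: "strand v b I k = strand v b J k"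
    if k: "k \<noteq> i" "k \<noteq> Suc i" "k \<le> Suc (length v)" for k
  proof -
    have lev: "level ` strand v b I k = {int k, int k + 1}" by (rule level_strand[OF k(3)])
    have "strand v b I k \<noteq> near_edge v i x" for x
      using lev level_near_edge[OF i, of x] k by (metis level_pair_eq_iff)
    moreover have "strand v b I k \<noteq> far_edge v i x" for x
      using lev level_far_edge[OF i, of x] k by (metis level_pair_eq_iff)
    moreover have "strand v b I k \<in> strands v b I" using k by (auto simp: strands_def)
    ultimately have "strand v b I k \<in> strands v b J" using flip by (auto simp: flips_def)
    then show ?thesis using mem_strands_iff[OF lev k(3)] by blast
  qed
  have others: "j \<in> I \<longleftrightarrow> j \<in> J" if j: "j \<noteq> i" "j \<le> length v" for j
  proof (cases "j = Suc i")
    case True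
    then show ?thesis using j same[of "Suc j"] strand_mem_lower[of j v b I J] by auto
  next
    case False
    then show ?thesis using j same[of j] strand_mem_upper[of j v b I J] by auto
  qed
  have "J = insert i I"
    using others iIJ I J by (intro set_eqI) (metis atMost_iff insert_iff subsetD)
  then show ?thesis using iIJ by simp
qed

text \<open>
  Since both \<open>I\<close> and \<open>insert i I\<close> are ideals, the chosen vertex below level \<open>i + 1\<close> is adjacent to
  both vertices of that level, so it is the south-west vertex of the tile. Likewise the chosen vertex
  above is the north-east one, and the two strands are edges of the tile.
\<close>

lemma insert_imp_flips:
  assumes I: "I \<in> fence_ideals (twisted b v)" and J: "insert i I \<in> fence_ideals (twisted b v)"
    and i: "i \<notin> I"
  shows "i \<le> length v \<and> flips v b i (strands v b I) (strands v b (insert i I))"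
proof -
  let ?J = "insert i I" and ?K = "{..Suc (length v)}"
  have il: "i \<le> length v" using J by (auto simp: fence_ideals_def)
  have iI: "node v (Suc i) ((i \<in> I) \<noteq> x) = corner v i x"
    and iJ: "node v (Suc i) ((i \<in> ?J) \<noteq> x) = corner v i (\<not> x)" for x
    using i il by (auto simp: node.simps)
  have step: "step (node v k ((k - 1 \<in> I) \<noteq> b k)) (node v (Suc k) ((k \<in> I) \<noteq> b k))"
    "step (node v k ((k - 1 \<in> ?J) \<noteq> b k)) (node v (Suc k) ((k \<in> ?J) \<noteq> b k))"
    if "k \<le> Suc (length v)" for k
    using I J that unfolding fence_ideals_twisted by blast+
  have "node v i ((i - 1 \<in> ?J) \<noteq> b i) = node v i ((i - 1 \<in> I) \<noteq> b i)"
    by (cases i) (auto simp: node.simps)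
  then have lo: "node v i ((i - 1 \<in> I) \<noteq> b i) = tile_at v i" "node v i ((i - 1 \<in> ?J) \<noteq> b i) = tile_at v i"
    using step[of i] il unfolding iI iJ
    by (auto simp: step_def corner_def right_def above_def prod_eq_iff split: if_splits)
  have hi: "node v (Suc (Suc i)) ((Suc i \<in> I) \<noteq> b (Suc i)) = far_corner v i"
    "node v (Suc (Suc i)) ((Suc i \<in> ?J) \<noteq> b (Suc i)) = far_corner v i"
    using step[of "Suc i"] il unfolding diff_Suc_1 iI iJ
    by (auto simp: step_def corner_def far_corner_def right_def above_def prod_eq_iff split: if_splits)
  have eq: "strand v b I i = near_edge v i (b i)" "strand v b ?J i = near_edge v i (\<not> b i)"
    "strand v b I (Suc i) = far_edge v i (b (Suc i))" "strand v b ?J (Suc i) = far_edge v i (\<not> b (Suc i))"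
    unfolding strand_def near_edge_def far_edge_def lo hi diff_Suc_1 iI iJ by (rule refl)+
  have same: "strand v b ?J k = strand v b I k" if "k \<noteq> i" "k \<noteq> Suc i" for k
    using that by (cases k) (auto simp: strand_def node.simps)
  have inj: "inj_on (strand v b I) ?K"
    by (rule inj_onI) (use level_strand in \<open>metis atMost_iff level_pair_eq_iff\<close>)
  have K: "?K = {i, Suc i} \<union> (?K - {i, Suc i})" using il by auto
  have "strands v b ?J = strand v b ?J ` {i, Suc i} \<union> strand v b ?J ` (?K - {i, Suc i})"
    unfolding strands_def image_Un[symmetric] using K by simp
  also have "strand v b ?J ` (?K - {i, Suc i}) = strand v b I ` (?K - {i, Suc i})"
    by (intro image_cong refl) (use same in auto)
  also have "strand v b I ` (?K - {i, Suc i}) = strands v b I - strand v b I ` {i, Suc i}"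
    unfolding strands_def by (rule inj_on_image_set_diff[OF inj]) (use il in auto)
  finally have "strands v b ?J = strand v b ?J ` {i, Suc i} \<union> (strands v b I - strand v b I ` {i, Suc i})" .
  moreover have "strand v b I ` {i, Suc i} \<subseteq> strands v b I"
    unfolding strands_def using il by (intro image_mono) auto
  ultimately show ?thesis using il unfolding flips_def image_insert image_empty eq by blast
qed

lemma flips_iff_insert:
  assumes "I \<in> fence_ideals (twisted b v)" "J \<in> fence_ideals (twisted b v)"
  shows "(\<exists>i\<le>length v. flips v b i (strands v b I) (strands v b J)) \<longleftrightarrow> (\<exists>i. i \<notin> I \<and> J = insert i I)"
proof -
  have "I \<subseteq> {..length v}" "J \<subseteq> {..length v}" using assms by (simp_all add: fence_ideals_twisted)
  then have "i \<le> length v \<and> flips v b i (strands v b I) (strands v b J) \<longleftrightarrow>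
      i \<notin> I \<and> J = insert i I" for i
    using flips_imp_insert[of i v I J b] insert_imp_flips[of I b v i] assms by metis
  then show ?thesis by simp
qed

section \<open>Lattice paths\<close>

definition no_twist :: "nat \<Rightarrow> bool" where
  "no_twist k = False"

definition path_of :: "word \<Rightarrow> nat set \<Rightarrow> path" where
  "path_of v I = map (\<lambda>k. node v k (k - 1 \<in> I)) [0..<length v + 3]"

lemma twisted_no_twist [simp]: "twisted no_twist v = v"
  by (rule nth_equalityI) (auto simp: twisted_def no_twist_def)

lemma length_path_of [simp]: "length (path_of v I) = length v + 3"
  by (simp add: path_of_def)

lemma nth_path_of: "k \<le> length v + 2 \<Longrightarrow> path_of v I ! k = node v k (k - 1 \<in> I)"
  unfolding path_of_def by (subst nth_map) (auto simp del: upt_Suc)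

lemma path_edges_path_of: "path_edges (path_of v I) = strands v no_twist I"
proof -
  have "{path_of v I ! k, path_of v I ! Suc k} = strand v no_twist I k" if "k \<le> Suc (length v)" for k
    using that by (simp add: nth_path_of strand_def no_twist_def)
  moreover have "Suc k < length (path_of v I) \<longleftrightarrow> k \<le> Suc (length v)" for k by auto
  ultimately show ?thesis unfolding path_edges_def strands_def by (auto simp: image_iff)
qed

lemma strand_in_edges:
  assumes "I \<in> fence_ideals (twisted b v)" "k \<le> Suc (length v)"
  shows "strand v b I k \<in> edges (snake v)"
proof -
  have "node v k x \<in> vertices (snake v)" "node v (Suc k) x \<in> vertices (snake v)" for x
    using assms(2) unfolding vertices_snake by force+
  then show ?thesis
    using assms unfolding edges_snake strand_def fence_ideals_twisted by blast
qed

lemma node_top: "node v (length v + 2) x = above (right (last (snake v)))"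
  by (simp add: node.simps far_corner_def last_conv_nth flip: length_greater_0_conv)

lemma hd_snake: "hd (snake v) = node v 0 x"
  by (subst hd_conv_nth) (simp_all add: node.simps flip: length_greater_0_conv)

lemma path_of_in_lattice_paths:
  assumes I: "I \<in> fence_ideals v"
  shows "path_of v I \<in> lattice_paths (snake v)"
proof -
  have I': "I \<in> fence_ideals (twisted no_twist v)" using I by simp
  have ne: "path_of v I \<noteq> []" by (simp flip: length_greater_0_conv)
  moreover have "hd (path_of v I) = hd (snake v)"
    by (simp add: hd_conv_nth[OF ne] hd_snake[of v "0 \<in> I"] nth_path_of)
  moreover have "last (path_of v I) = above (right (last (snake v)))"
    using node_top by (simp add: last_conv_nth[OF ne] nth_path_of)
  moreover have "path_of v I ! Suc k = right (path_of v I ! k) \<or> path_of v I ! Suc k = above (path_of v I ! k)"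
    if "Suc k < length (path_of v I)" for k
    using I' that unfolding fence_ideals_twisted
    by (auto simp: nth_path_of step_def no_twist_def)
  moreover have "path_edges (path_of v I) \<subseteq> edges (snake v)"
    unfolding path_edges_path_of strands_def using strand_in_edges[OF I'] by auto
  ultimately show ?thesis by (simp add: lattice_paths_def)
qed

lemma edge_vertices: "e \<in> edges (snake v) \<Longrightarrow> p \<in> e \<Longrightarrow> p \<in> vertices (snake v)"
  by (auto simp: edges_snake)

text \<open>
  Each step raises the level by one, so a path visits one vertex of each level, and the bits can be
  read off.
\<close>

lemma lattice_path_is_path_of:
  assumes p: "p \<in> lattice_paths (snake v)"
  shows "\<exists>I\<in>fence_ideals v. p = path_of v I"
proof -
  have ne: "p \<noteq> []" and hd: "p ! 0 = node v 0 False" and last: "p ! (length p - 1) = node v (length v + 2) False"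
    using p unfolding lattice_paths_def node_top
    by (auto simp: hd_snake[of v False] hd_conv_nth last_conv_nth)
  have st: "step (p ! k) (p ! Suc k)" if "Suc k < length p" for k
    using p that by (auto simp: lattice_paths_def step_def)
  have lev: "level (p ! k) = int k" if "k < length p" for k
    using that
  proof (induction k)
    case 0 show ?case using level_node[of 0 v False] by (simp add: hd)
  next
    case (Suc k) then show ?case using step_level[OF st[of k]] by simp
  qed
  have "int (length p - 1) = int (length v + 2)"
    using lev[of "length p - 1"] ne last level_node[of "length v + 2" v False] by simp
  then have len: "length p = length v + 3" using ne by (cases p) auto
  have vert: "p ! k \<in> vertices (snake v)" if "Suc k < length p" for k
  proof -
    have "{p ! k, p ! Suc k} \<in> edges (snake v)"
      using p that by (auto simp: lattice_paths_def path_edges_def)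
    then show ?thesis using edge_vertices by blast
  qed
  define I where "I = {i. i \<le> length v \<and> p ! Suc i = corner v i True}"
  have nth: "p ! k = node v k (k - 1 \<in> I)" if k: "k \<le> length v + 2" for k
  proof -
    consider "k = 0" | "k = length v + 2" | i where "k = Suc i" "i \<le> length v"
      using k by (cases k) (auto, linarith)
    then show ?thesis
    proof cases
      case 1 then show ?thesis by (simp add: hd node.simps(1))
    next
      case 2 then show ?thesis using last len by (simp add: node.simps(2))
    next
      case (3 i)
      then obtain x where "p ! k = node v k x"
        using vert[of k] lev[of k] vertex_levelE[of "p ! k" v k] len by auto
      then show ?thesis using 3 by (auto simp: I_def node.simps(2))
    qed
  qed
  have "p = path_of v I"
    by (rule nth_equalityI) (use len nth nth_path_of in auto)
  moreover have "I \<in> fence_ideals (twisted no_twist v)"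
    unfolding fence_ideals_twisted
  proof (intro conjI allI impI)
    show "I \<subseteq> {..length v}" by (auto simp: I_def)
    fix k assume "k \<le> Suc (length v)"
    then show "step (node v k ((k - 1 \<in> I) \<noteq> no_twist k)) (node v (Suc k) ((k \<in> I) \<noteq> no_twist k))"
      using st[of k] nth[of k] nth[of "Suc k"] len by (simp add: no_twist_def)
  qed
  ultimately show ?thesis by auto
qed

lemma path_covers_iff:
  assumes I: "I \<in> fence_ideals v" and J: "J \<in> fence_ideals v"
  shows "(path_of v I, path_of v J) \<in> path_covers (snake v) \<longleftrightarrow> (\<exists>i. i \<notin> I \<and> J = insert i I)"
proof -
  have "(path_of v I, path_of v J) \<in> path_covers (snake v) \<longleftrightarrow>
      (\<exists>i\<le>length v. flips v no_twist i (strands v no_twist I) (strands v no_twist J))"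
    unfolding path_covers_def flips_def path_edges_path_of near_edge_def far_edge_def
    using path_of_in_lattice_paths[OF I] path_of_in_lattice_paths[OF J]
    by (simp add: set_snake path_edges_path_of tile_edges no_twist_def insert_commute Bex_def)
  then show ?thesis using flips_iff_insert[of I no_twist v J] I J by simp
qed

lemma path_poset_rank_symmetric:
  assumes "rev v = v"
  shows "rank_symmetric (generated_order (lattice_paths (snake v)) (path_covers (snake v))) (Suc (length v))"
proof (rule rank_symmetric_of_fence[OF assms, of "path_of v"])
  show "inj_on (path_of v) (fence_ideals v)"
  proof (rule inj_onI)
    fix I J assume "I \<in> fence_ideals v" "J \<in> fence_ideals v" "path_of v I = path_of v J"
    then show "I = J"
      using strands_inj[of I v J no_twist] path_edges_path_of[of v I] path_edges_path_of[of v J]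
      by (simp add: fence_ideals_def)
  qed
  show "lattice_paths (snake v) = path_of v ` fence_ideals v"
    using path_of_in_lattice_paths lattice_path_is_path_of by blast
  show "path_covers (snake v) \<subseteq> lattice_paths (snake v) \<times> lattice_paths (snake v)"
    by (auto simp: path_covers_def)
qed (rule path_covers_iff)

section \<open>Perfect matchings\<close>

lemma twisted_odd: "twisted odd v = dual v"
  by (simp add: twisted_def dual_def)

lemma node_eq_iff: "i \<le> length v \<Longrightarrow> node v (Suc i) x = node v (Suc i) y \<longleftrightarrow> x = y"
  by (simp add: node.simps)

text \<open>
  At an inner level the bits of the two adjacent strands are complementary, because the parities
  of \<open>i\<close> and \<open>i + 1\<close> differ. So each vertex is on exactly one of the two.
\<close>

lemma node_mem_strand_iff:
  assumes "i \<le> length v" "k \<le> Suc (length v)"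
  shows "node v (Suc i) x \<in> strand v odd I k \<longleftrightarrow>
    k = (if x \<longleftrightarrow> (i \<in> I) \<noteq> odd i then i else Suc i)"
proof -
  have lev: "level (node v (Suc i) x) = int (Suc i)" using assms(1) by (simp add: level_node)
  have "node v (Suc i) x \<notin> strand v odd I k" if "k \<noteq> i" "k \<noteq> Suc i"
  proof
    assume "node v (Suc i) x \<in> strand v odd I k"
    then have "int (Suc i) \<in> {int k, int k + 1}"
      using lev level_strand[OF assms(2), of odd I] by (metis imageI)
    then show False using that by auto
  qed
  moreover have "node v (Suc i) x \<in> strand v odd I i \<longleftrightarrow> (x \<longleftrightarrow> (i \<in> I) \<noteq> odd i)"
  proof -
    have "node v (Suc i) x \<noteq> node v i y" for y
      using level_node[of i v y] level_node[of "Suc i" v x] assms(1) by (auto)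
    then show ?thesis using assms(1) by (auto simp: strand_def node_eq_iff)
  qed
  moreover have "node v (Suc i) x \<in> strand v odd I (Suc i) \<longleftrightarrow> (x \<longleftrightarrow> (i \<in> I) \<noteq> odd (Suc i))"
  proof -
    have "node v (Suc i) x \<noteq> node v (Suc (Suc i)) y" for y
      using level_node[of "Suc (Suc i)" v y] level_node[of "Suc i" v x] assms(1) by (auto)
    then show ?thesis using assms(1) by (auto simp: strand_def node_eq_iff)
  qed
  ultimately show ?thesis by (cases "k = i"; cases "k = Suc i") auto
qed

lemma strands_perfect_matching:
  assumes I: "I \<in> fence_ideals (dual v)"
  shows "strands v odd I \<in> perfect_matchings (snake v)"
proof -
  have I': "I \<in> fence_ideals (twisted odd v)" using I by (simp add: twisted_odd)
  have "strands v odd I \<subseteq> edges (snake v)"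
    unfolding strands_def using strand_in_edges[OF I'] by auto
  moreover have "\<exists>!e. e \<in> strands v odd I \<and> p \<in> e" if p: "p \<in> vertices (snake v)" for p
  proof -
    have "\<exists>k\<le>Suc (length v). \<forall>j\<le>Suc (length v). p \<in> strand v odd I j \<longleftrightarrow> j = k"
    proof -
      obtain k x where k: "p = node v k x" "k \<le> length v + 2" using p by (auto simp: vertices_snake)
      have lev: "level p = int j \<or> level p = int j + 1" if "j \<le> Suc (length v)" "p \<in> strand v odd I j" for j
        using level_strand[OF that(1), of odd I] that(2) by auto
      have levp: "level p = int k" using k level_node by simp
      consider "k = 0" | "k = length v + 2" | i where "k = Suc i" "i \<le> length v"
        using k(2) by (cases k) (auto, linarith)
      then show ?thesis
      proof cases
        case 1
        then have "p \<in> strand v odd I 0" using k by (simp add: strand_def node.simps(1))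
        then show ?thesis using lev levp 1 by (intro exI[of _ 0]) auto
      next
        case 2
        then have "p \<in> strand v odd I (Suc (length v))" using k by (simp add: strand_def node.simps(2))
        then show ?thesis using lev levp 2 by (intro exI[of _ "Suc (length v)"]) force
      next
        case (3 i)
        then show ?thesis unfolding k(1) 3(1) using node_mem_strand_iff[OF 3(2), of _ x I]
          by (intro exI[of _ "if x \<longleftrightarrow> (i \<in> I) \<noteq> odd i then i else Suc i"]) auto
      qed
    qed
    then show ?thesis by (auto simp: strands_def)
  qed
  ultimately show ?thesis by (simp add: perfect_matchings_def)
qed

lemma edge_levelE:
  assumes "e \<in> edges (snake v)"
  obtains k x y where "k \<le> Suc (length v)" "e = {node v k x, node v (Suc k) y}"
    "step (node v k x) (node v (Suc k) y)"
proof -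
  obtain p q where pq: "e = {p, q}" "p \<in> vertices (snake v)" "q \<in> vertices (snake v)" "step p q"
    using assms unfolding edges_snake by blast
  from step_levelE[OF pq(2-4)] show ?thesis using that pq by metis
qed

text \<open>
  Induction on the level \<open>k\<close> shows that the matching has exactly one edge between the levels \<open>k\<close>
  and \<open>k + 1\<close>, namely the strand. At level \<open>0\<close> the only vertex has one edge, which goes up. At a later
  level, the unique edge from below covers one of the two vertices; the edge at the other vertex must
  go up, and any further edge going up would start at a vertex that is already covered.
\<close>

lemma perfect_matching_is_strands:
  assumes M: "M \<in> perfect_matchings (snake v)"
  shows "\<exists>I\<in>fence_ideals (dual v). M = strands v odd I"
proof -
  let ?n = "length v"
  (* The upper end of the edge from level i to i + 1 determines the bit of tile i, up to the sign
     that strand attaches to that edge. *)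
  define I where "I = {i. i \<le> ?n \<and>
    ((\<exists>e\<in>M. level ` e = {int i, int i + 1} \<and> corner v i True \<in> e) \<noteq> odd i)}"
  have sub: "M \<subseteq> edges (snake v)" using M by (simp add: perfect_matchings_def)
  have cover: "\<exists>e\<in>M. node v k x \<in> e" if "k \<le> ?n + 2" for k x
  proof -
    have "node v k x \<in> vertices (snake v)" using that unfolding vertices_snake by blast
    then show ?thesis using M unfolding perfect_matchings_def by blast
  qed
  have uniq: "e = f" if "e \<in> M" "f \<in> M" "p \<in> e" "p \<in> f" for e f p
  proof -
    have "p \<in> vertices (snake v)" using edge_vertices that(1,3) sub by blast
    then have "\<exists>!e. e \<in> M \<and> p \<in> e" using M unfolding perfect_matchings_def by blast
    then show ?thesis using that by blast
  qed
  have shape: "\<exists>x y. e = {node v k x, node v (Suc k) y} \<and> step (node v k x) (node v (Suc k) y)"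
    if e: "e \<in> M" "level ` e = {int k, int k + 1}" for e k
  proof -
    obtain j x y where j: "j \<le> Suc ?n" "e = {node v j x, node v (Suc j) y}"
      "step (node v j x) (node v (Suc j) y)"
      using edge_levelE e(1) sub by blast
    then have "j = k" using e(2) by (auto simp: level_node doubleton_eq_iff)
    then show ?thesis using j by blast
  qed
  have incident: "level ` e = {int k, int k + 1} \<or> (k \<noteq> 0 \<and> level ` e = {int (k - 1), int (k - 1) + 1})"
    if e: "e \<in> M" "node v k x \<in> e" "k \<le> ?n + 2" for e k x
  proof -
    obtain j y z where j: "j \<le> Suc ?n" "e = {node v j y, node v (Suc j) z}"
      using edge_levelE e(1) sub by blast
    then have "level ` e = {int j, int j + 1}" by (simp add: level_node add.commute)
    moreover have "k = j \<or> k = Suc j"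
      using j e(2,3) level_node[of k v x] level_node[of j v y] level_node[of "Suc j" v z]
      by (auto)
    ultimately show ?thesis by auto
  qed
  (* Once the edge of M on the levels k and k + 1 is unique, its upper end is the one that I encodes. *)
  have upper: "node v (Suc k) ((k \<in> I) \<noteq> odd k) = node v (Suc k) y"
    if e: "e \<in> M" "e = {node v k x, node v (Suc k) y}" "k \<le> Suc ?n"
      and only: "\<And>f. f \<in> M \<Longrightarrow> level ` f = {int k, int k + 1} \<Longrightarrow> f = e" for e k x y
  proof (cases "k \<le> ?n")
    case True
    have lev: "level ` e = {int k, int k + 1}" using e by (simp add: level_node add.commute)
    have "corner v k True \<noteq> node v k x"
      using True level_node[of "Suc k" v True] level_node[of k v x] by (auto simp: node.simps(2))
    then have "corner v k True \<in> e \<longleftrightarrow> y" using e(2) True by (auto simp: node.simps(2))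
    then have "(k \<in> I) \<noteq> odd k \<longleftrightarrow> y" using lev only e(1) True unfolding I_def by blast
    then show ?thesis by simp
  qed (simp add: node.simps)
  have key: "strand v odd I k \<in> M \<and> (\<forall>e\<in>M. level ` e = {int k, int k + 1} \<longrightarrow> e = strand v odd I k)"
    if "k \<le> Suc ?n" for k
    using that
  proof (induction k)
    case 0
    obtain e where e: "e \<in> M" "node v 0 False \<in> e" using cover[of 0] by auto
    then have lev: "level ` e = {int 0, int 0 + 1}" using incident[of e 0 False] by blast
    obtain x y where xy: "e = {node v 0 x, node v (Suc 0) y}" using shape[OF e(1) lev] by blast
    have only: "f = e" if f: "f \<in> M" "level ` f = {int 0, int 0 + 1}" for f
    proof -
      have "node v 0 False \<in> f" using shape[OF f] by (auto simp: node.simps(1))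
      then show ?thesis using uniq e f by blast
    qed
    have eq: "strand v odd I 0 = e"
      unfolding strand_def using upper[OF e(1) xy _ only] by (simp add: xy node.simps(1))
    show ?case unfolding eq using e(1) only by blast
  next
    case (Suc k)
    then have k: "k \<le> ?n" and IH: "strand v odd I k \<in> M"
      "\<And>e. e \<in> M \<Longrightarrow> level ` e = {int k, int k + 1} \<Longrightarrow> e = strand v odd I k" by auto
    define b where "b \<longleftrightarrow> (k \<in> I) \<noteq> odd k"
    have upper_k: "node v (Suc k) x \<in> strand v odd I k \<longleftrightarrow> x = b" for x
      using node_mem_strand_iff[OF k, of k x I] k unfolding b_def by simp
    obtain e where e: "e \<in> M" "node v (Suc k) (\<not> b) \<in> e" using cover[of "Suc k"] k by auto
    have "e \<noteq> strand v odd I k" using e(2) upper_k[of "\<not> b"] by auto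
    then have lev: "level ` e = {int (Suc k), int (Suc k) + 1}"
      using incident[OF e] IH(2)[OF e(1)] k by auto
    obtain x y where xy: "e = {node v (Suc k) x, node v (Suc (Suc k)) y}"
      using shape[OF e(1) lev] by blast
    have only: "f = e" if f: "f \<in> M" "level ` f = {int (Suc k), int (Suc k) + 1}" for f
    proof -
      obtain x' y' where f': "f = {node v (Suc k) x', node v (Suc (Suc k)) y'}"
        using shape[OF f] by blast
      have "x' \<noteq> b"
      proof
        assume "x' = b"
        then have "f = strand v odd I k" using uniq[OF f(1) IH(1)] f' upper_k by blast
        then have "{int k, int k + 1} = {int (Suc k), int (Suc k) + 1}"
          using f(2) level_strand[of k v odd I] k by simp
        then show False unfolding level_pair_eq_iff by simp
      qed
      then have "x' = (\<not> b)" by blast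
      then show ?thesis using uniq[OF f(1) e(1) _ e(2)] f' by blast
    qed
    have "node v (Suc k) (\<not> b) \<noteq> node v (Suc (Suc k)) y"
      using k level_node[of "Suc k" v "\<not> b"] level_node[of "Suc (Suc k)" v y] by auto
    then have "node v (Suc k) (\<not> b) = node v (Suc k) x" using e(2) xy by blast
    moreover have "((Suc k - 1 \<in> I) \<noteq> odd (Suc k)) = (\<not> b)" by (auto simp: b_def)
    ultimately have eq: "strand v odd I (Suc k) = e"
      unfolding strand_def using upper[OF e(1) xy Suc.prems only] by (simp only: xy diff_Suc_1)
    show ?case unfolding eq using e(1) only by blast
  qed
  have MI: "M = strands v odd I"
  proof (intro equalityI subsetI)
    fix e assume e: "e \<in> M"
    then obtain k x y where k: "k \<le> Suc ?n" and xy: "e = {node v k x, node v (Suc k) y}"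
      using edge_levelE sub by blast
    have "level ` e = {int k, int k + 1}" unfolding xy using k by (simp add: level_node add.commute)
    then have "e = strand v odd I k" using key[OF k] e by blast
    then show "e \<in> strands v odd I" using k by (simp add: strands_def)
  next
    fix e assume "e \<in> strands v odd I"
    then show "e \<in> M" using key by (auto simp: strands_def)
  qed
  have "I \<in> fence_ideals (twisted odd v)"
    unfolding fence_ideals_twisted
  proof (intro conjI allI impI)
    show "I \<subseteq> {..?n}" by (auto simp: I_def)
    fix k assume k: "k \<le> Suc ?n"
    then obtain x y where xy: "strand v odd I k = {node v k x, node v (Suc k) y}"
      "step (node v k x) (node v (Suc k) y)"
      using shape[of "strand v odd I k" k] key[OF k] level_strand[OF k] by metis
    have "node v k ((k - 1 \<in> I) \<noteq> odd k) = node v k x \<and> node v (Suc k) ((k \<in> I) \<noteq> odd k) = node v (Suc k) y"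
      using xy(1) unfolding strand_def by (rule doubleton_level_eq) (use k in \<open>simp_all add: level_node\<close>)
    then show "step (node v k ((k - 1 \<in> I) \<noteq> odd k)) (node v (Suc k) ((k \<in> I) \<noteq> odd k))"
      using xy(2) by simp
  qed
  then show ?thesis using MI by (auto simp: twisted_odd)
qed

text \<open>
  At a tile of even index the removed edges are the near edge \<open>south\<close> and the far edge \<open>north\<close>; at
  odd index they are the near edge \<open>west\<close> and the far edge \<open>east\<close>. These are the corners that the
  alternating signs select.
\<close>

lemma up_twist_iff_flips:
  "up_twist (snake v) i M N \<longleftrightarrow> flips v odd i M N"
  unfolding up_twist_def flips_def near_edge_def far_edge_def Let_def tile_edges
  by (cases "even i") (simp_all add: insert_commute)

lemma matching_covers_iff:
  assumes I: "I \<in> fence_ideals (dual v)" and J: "J \<in> fence_ideals (dual v)"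
  shows "(strands v odd I, strands v odd J) \<in> matching_covers (snake v) \<longleftrightarrow> (\<exists>i. i \<notin> I \<and> J = insert i I)"
proof -
  have "(strands v odd I, strands v odd J) \<in> matching_covers (snake v) \<longleftrightarrow>
      (\<exists>i\<le>length v. flips v odd i (strands v odd I) (strands v odd J))"
    unfolding matching_covers_def
    using strands_perfect_matching[OF I] strands_perfect_matching[OF J]
    by (simp add: up_twist_iff_flips less_Suc_eq_le)
  then show ?thesis using flips_iff_insert[of I odd v J] I J by (simp add: twisted_odd)
qed

lemma length_dual [simp]: "length (dual w) = length w"
  by (simp add: dual_def)

lemma matching_poset_rank_symmetric:
  assumes "rev (dual v) = dual v"
  shows "rank_symmetric (generated_order (perfect_matchings (snake v)) (matching_covers (snake v))) (Suc (length v))"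
proof -
  have "rank_symmetric (generated_order (perfect_matchings (snake v)) (matching_covers (snake v)))
          (Suc (length (dual v)))"
  proof (rule rank_symmetric_of_fence[OF assms, of "strands v odd"])
    show "inj_on (strands v odd) (fence_ideals (dual v))"
      by (rule inj_onI, rule strands_inj) (auto simp: fence_ideals_def)
    show "perfect_matchings (snake v) = strands v odd ` fence_ideals (dual v)"
      using strands_perfect_matching perfect_matching_is_strands by blast
    show "matching_covers (snake v) \<subseteq> perfect_matchings (snake v) \<times> perfect_matchings (snake v)"
      by (auto simp: matching_covers_def)
  qed (rule matching_covers_iff)
  then show ?thesis by simp
qed

section \<open>Symmetric and self-conjugate words\<close>

lemma star_star [simp]: "star (star x) = x"
  by (cases x) auto

text \<open>
  A position and its mirror image have the same parity, so dualising changes both letters or none.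
\<close>

lemma rev_dual_odd:
  assumes "odd (length v)" "rev v = v"
  shows "rev (dual v) = dual v"
proof (rule nth_equalityI)
  fix i assume "i < length (rev (dual v))"
  then have i: "i < length v" by simp
  have "v ! i = v ! (length v - Suc i)" using assms(2) i by (metis rev_nth)
  moreover have "even (length v - Suc i) \<longleftrightarrow> even i" using assms(1) i by auto
  ultimately show "rev (dual v) ! i = dual v ! i" using i by (simp add: rev_nth dual_def)
qed simp

text \<open>
  A position and its mirror image have opposite parities, so dualising changes exactly one of two
  letters that are exchanged by \<open>star\<close>, and makes them equal.
\<close>

lemma rev_dual_even:
  assumes "even (length v)" "conjugate v = v"
  shows "rev (dual v) = dual v"
proof (rule nth_equalityI)
  fix i assume "i < length (rev (dual v))"
  then have i: "i < length v" by simp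
  have "v ! i = star (v ! (length v - Suc i))"
    using assms(2) i by (metis conjugate_def length_rev nth_map rev_nth)
  moreover have "even (length v - Suc i) \<longleftrightarrow> odd i" using assms(1) i by auto
  ultimately show "rev (dual v) ! i = dual v ! i" using i by (simp add: rev_nth dual_def)
qed simp

section \<open>Rank symmetry of the two lattices\<close>

theorem corollary9p11:
  fixes w :: word and n :: nat
  assumes "1 \<le> n" and "length w = n - 1"
  shows "(symmetric_word (shape (snake_of w)) \<longrightarrow> rank_symmetric (path_poset w) n) \<and>
         ((odd (n - 1) \<and> symmetric_word (shape (snake_of w)) \<or>
           even (n - 1) \<and> self_conjugate (shape (snake_of w)))
            \<longrightarrow> rank_symmetric (matching_poset w) n)"
proof -
  have n: "n = Suc (length (dual w))" and l: "n - 1 = length (dual w)" using assms by auto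
  show ?thesis
    unfolding l path_poset_def matching_poset_def snake_of_def shape_snake symmetric_word_def self_conjugate_def
    using path_poset_rank_symmetric[of "dual w"] matching_poset_rank_symmetric[of "dual w"]
      rev_dual_odd[of "dual w"] rev_dual_even[of "dual w"]
    unfolding n[symmetric] by blast
qed

end
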